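(* Let $F\colon\mathbb{B}^{2L}\to\mathbb{B}^{2L}$ be the Boolean Delta-Notch system over a graph $\mathcal{G}$ as in the context. For every $x\in\mathbb{B}^{2L}$ that is not a fixed point of $F$, there is a path in the asynchronous dynamics $AD_F$ from $x$ to a fixed point of $F$.
   Context: Let $L\ge 1$ and let $\mathcal{G}$ be an undirected connected graph without loops on the vertex set $C=\{1,\dots,L\}$. For $i\in C$ let $S(i)$ be the set of neighbours of $i$ in $\mathcal{G}$. $\mathbb{B}=\{0,1\}$. States of $\mathbb{B}^{2L}$ are written $(n,d)=(n_1,\dots,n_L,d_1,\dots,d_L)$. The Boolean Delta-Notch system is $F\colon\mathbb{B}^{2L}\to\mathbb{B}^{2L}$ with $F_i(n,d)=\bigvee_{j\in S(i)}d_j$ (empty disjunction $=0$) and $F_{i+L}(n,d)=1-n_i$ for $i\in C$. For a map $f\colon\mathbb{B}^m\to\mathbb{B}^m$, the asynchronous dynamics $AD_f$ is the directed graph on $\mathbb{B}^m$ with an edge from $x$ to the state obtained from $x$ by flipping coordinate $i$ whenever $f_i(x)\neq x_i$. A fixed point is $x$ with $f(x)=x$. *)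

theory Defs
  imports "Graph_Theory.Graph_Theory" "HOL-Library.FuncSet"
begin

text \<open>
  \<open>\<bool>\<close> is the type \<^typ>\<open>bool\<close>, and a state in \<open>\<bool>\<^sup>m\<close> is a function with coordinates indexed by
  \<open>1, \<dots>, m\<close>, extensional so that two states are equal iff all their coordinates are.
\<close>
definition cube :: "nat \<Rightarrow> (nat \<Rightarrow> bool) set" where
  "cube m = {1..m} \<rightarrow>\<^sub>E UNIV"

definition AD :: "nat \<Rightarrow> ((nat \<Rightarrow> bool) \<Rightarrow> nat \<Rightarrow> bool) \<Rightarrow> (nat \<Rightarrow> bool) pair_pre_digraph" where
  "AD m f = \<lparr>pverts = cube m,
     parcs = {(x, x(i := \<not> x i)) | x i. x \<in> cube m \<and> i \<in> {1..m} \<and> f x i \<noteq> x i}\<rparr>"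

text \<open>An undirected graph is a symmetric digraph, so the neighbours are the heads of outgoing arcs.\<close>
definition neighbours :: "'a pair_pre_digraph \<Rightarrow> 'a \<Rightarrow> 'a set" where
  "neighbours G i = {j. (i, j) \<in> parcs G}"

text \<open>In a state \<open>x = (n, d)\<close>, the coordinate \<open>n\<^sub>i\<close> is \<open>x i\<close> and \<open>d\<^sub>i\<close> is \<open>x (i + L)\<close>.\<close>
definition delta_notch ::
  "nat \<Rightarrow> nat pair_pre_digraph \<Rightarrow> (nat \<Rightarrow> bool) \<Rightarrow> nat \<Rightarrow> bool" where
  "delta_notch L G x = (\<lambda>k\<in>{1..2 * L}.
     if k \<le> L then \<exists>j\<in>neighbours G k. x (j + L) else \<not> x (k - L))"

end

theory Submission
  imports Defs
begin

text \<open>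
  After updating every Delta coordinate, the state has \<open>d = 1 - n\<close>, so it is encoded by the set
  \<open>D = {i. d\<^sub>i = 1}\<close>; it is a fixed point iff \<open>D\<close> is a maximal independent set of the graph.
  If \<open>i \<in> D\<close> has a neighbour in \<open>D\<close>, updating \<open>n\<^sub>i\<close> and then \<open>d\<^sub>i\<close> removes \<open>i\<close> from \<open>D\<close>; doing this
  as long as possible makes \<open>D\<close> independent. If \<open>i \<notin> D\<close> has no neighbour in \<open>D\<close>, the same two
  updates add \<open>i\<close> to \<open>D\<close> and preserve independence, so \<open>D\<close> can be enlarged until it is maximal.
\<close>

abbreviation async_reach ::
  "nat \<Rightarrow> ((nat \<Rightarrow> bool) \<Rightarrow> nat \<Rightarrow> bool) \<Rightarrow> (nat \<Rightarrow> bool) \<Rightarrow> (nat \<Rightarrow> bool) \<Rightarrow> bool" where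
  "async_reach m f x y \<equiv> x \<rightarrow>\<^sup>*\<^bsub>with_proj (AD m f)\<^esub> y"

lemma cube_upd: "x \<in> cube m \<Longrightarrow> i \<in> {1..m} \<Longrightarrow> x(i := b) \<in> cube m"
  by (auto simp: cube_def PiE_def extensional_def)

lemma wf_digraph_AD: "wf_digraph (with_proj (AD m f))"
proof -
  have "pair_wf_digraph (AD m f)"
    by unfold_locales (auto simp: AD_def cube_upd)
  then show ?thesis
    by (simp add: wf_digraph_wp_iff)
qed

lemma async_reach_refl: "x \<in> cube m \<Longrightarrow> async_reach m f x x"
  by (rule wf_digraph.reachable_refl[OF wf_digraph_AD]) (simp add: AD_def)

lemma async_reach_trans: "async_reach m f x y \<Longrightarrow> async_reach m f y z \<Longrightarrow> async_reach m f x z"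
  by (rule wf_digraph.reachable_trans[OF wf_digraph_AD])

lemma async_reach_flip:
  assumes "x \<in> cube m" and "i \<in> {1..m}" and "f x i \<noteq> x i"
  shows "async_reach m f x (x(i := \<not> x i))"
  by (rule wf_digraph.reachable_adjI[OF wf_digraph_AD]) (use assms in \<open>auto simp: AD_def\<close>)

text \<open>Encodes the states with d = 1 - n, those in which every Delta coordinate is stable. Only
  \<open>D \<inter> {1..L}\<close> matters.\<close>

definition delta_state :: "nat \<Rightarrow> nat set \<Rightarrow> nat \<Rightarrow> bool" where
  "delta_state L D = (\<lambda>k\<in>{1..2 * L}. if k \<le> L then k \<notin> D else k - L \<in> D)"

lemma delta_state_cube: "delta_state L D \<in> cube (2 * L)"
  by (auto simp: delta_state_def cube_def)

lemma delta_state_simps: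
  assumes "i \<in> {1..L}"
  shows "delta_state L D i \<longleftrightarrow> i \<notin> D" and "delta_state L D (i + L) \<longleftrightarrow> i \<in> D"
  using assms by (auto simp: delta_state_def)

lemma delta_notch_simps:
  assumes "i \<in> {1..L}"
  shows "delta_notch L G x i \<longleftrightarrow> (\<exists>j\<in>neighbours G i. x (j + L))"
    and "delta_notch L G x (i + L) \<longleftrightarrow> \<not> x i"
  using assms by (auto simp: delta_notch_def)

lemma delta_notch_delta_state:
  assumes "neighbours G i \<subseteq> {1..L}" and "i \<in> {1..L}"
  shows "delta_notch L G (delta_state L D) i \<longleftrightarrow> neighbours G i \<inter> D \<noteq> {}"
  using assms by (auto simp: delta_notch_simps delta_state_simps subset_iff)

text \<open>Delta coordinates are stable for every \<open>D\<close>. The equivalence makes the Notch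
  coordinates stable: left to right it is independence, right to left maximality.\<close>

lemma delta_state_fixed:
  assumes nb: "\<And>i. neighbours G i \<subseteq> {1..L}"
    and D: "\<And>i. i \<in> {1..L} \<Longrightarrow> i \<in> D \<longleftrightarrow> neighbours G i \<inter> D = {}"
  shows "delta_notch L G (delta_state L D) = delta_state L D"
proof
  fix k
  consider "k \<in> {1..L}" | i where "i \<in> {1..L}" "k = i + L" | "k \<notin> {1..2 * L}"
  proof (cases "k \<in> {1..2 * L} \<and> L < k")
    case True
    then have "k - L \<in> {1..L}" "k = k - L + L" by auto
    then show ?thesis using that(2) by blast
  qed (use that in force)
  then show "delta_notch L G (delta_state L D) k = delta_state L D k"
  proof cases
    case 1
    then show ?thesis
      using D[of k] by (simp add: delta_notch_delta_state[OF nb] delta_state_simps)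
  next
    case 2
    then show ?thesis by (simp add: delta_notch_simps delta_state_simps)
  next
    case 3
    then show ?thesis by (auto simp: delta_notch_def delta_state_def restrict_def)
  qed
qed

text \<open>Delta updates read only Notch coordinates, which they leave unchanged, so they can be
  done one by one with targets fixed by the initial \<open>x\<close>. The set \<open>A\<close> of
  cells already treated is there for the induction.\<close>

lemma async_reach_complement_delta:
  assumes "x \<in> cube (2 * L)" and "finite A" and "A \<subseteq> {1..L}"
  shows "async_reach (2 * L) (delta_notch L G) x
    (\<lambda>k. if L < k \<and> k - L \<in> A then \<not> x (k - L) else x k)"
  using assms(2,3)
proof (induction A rule: finite_induct)
  case empty
  then show ?case using async_reach_refl[OF assms(1)] by simp
next
  case (insert a A)
  define y where "y = (\<lambda>k. if L < k \<and> k - L \<in> A then \<not> x (k - L) else x k)"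
  have a: "a \<in> {1..L}" and "A \<subseteq> {1..L}" using insert.prems by auto
  then have "k \<le> 2 * L" if "k - L \<in> A" for k using that by fastforce
  then have y: "y \<in> cube (2 * L)"
    using assms(1) by (auto simp: y_def cube_def PiE_def extensional_def)
  have reach: "async_reach (2 * L) (delta_notch L G) x y"
    using insert by (simp add: y_def)
  have upd: "(\<lambda>k. if L < k \<and> k - L \<in> insert a A then \<not> x (k - L) else x k) = y(a + L := \<not> x a)"
    using a by (auto simp: y_def fun_eq_iff)
  show ?case
  \<comment> \<open>An arc always flips a coordinate, so a coordinate already at its target
    contributes no arc.\<close>
  proof (cases "y (a + L) = (\<not> x a)")
    case True
    then have "y(a + L := \<not> x a) = y" by (rule fun_upd_idem)
    then show ?thesis using reach upd by simp
  next
    case False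
    moreover have "y a = x a" using a by (auto simp: y_def)
    ultimately have "async_reach (2 * L) (delta_notch L G) y (y(a + L := \<not> y (a + L)))"
      using a y by (intro async_reach_flip) (auto simp: delta_notch_simps)
    moreover have "y(a + L := \<not> y (a + L)) = y(a + L := \<not> x a)" using False by auto
    ultimately have "async_reach (2 * L) (delta_notch L G) y (y(a + L := \<not> x a))" by simp
    then show ?thesis unfolding upd by (rule async_reach_trans[OF reach])
  qed
qed

lemma async_reach_delta_state:
  assumes "x \<in> cube (2 * L)"
  shows "async_reach (2 * L) (delta_notch L G) x (delta_state L {i. \<not> x i})"
proof -
  have "(\<lambda>k. if L < k \<and> k - L \<in> {1..L} then \<not> x (k - L) else x k) = delta_state L {i. \<not> x i}"
    using assms by (auto simp: delta_state_def fun_eq_iff cube_def PiE_def extensional_def)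
  then show ?thesis
    using async_reach_complement_delta[OF assms, of "{1..L}" G] by simp
qed

text \<open>By \<open>flip\<close>, the Notch coordinate of \<open>i\<close> is unstable. Flipping
  it breaks d = 1 - n at \<open>i\<close> alone, so the Delta coordinate can be flipped next, which
  restores the encoded form. Describing \<open>D'\<close> pointwise covers both removal and
  insertion.\<close>

lemma async_reach_toggle:
  assumes nb: "neighbours G i \<subseteq> {1..L}" and i: "i \<in> {1..L}"
    and flip: "i \<in> D \<longleftrightarrow> neighbours G i \<inter> D \<noteq> {}"
    and D': "\<And>k. k \<in> D' \<longleftrightarrow> (if k = i then i \<notin> D else k \<in> D)"
  shows "async_reach (2 * L) (delta_notch L G) (delta_state L D) (delta_state L D')"
proof -
  let ?s = "delta_state L D"
  let ?t = "?s(i := \<not> ?s i)"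
  have t: "?t \<in> cube (2 * L)"
    using i by (intro cube_upd delta_state_cube) auto
  have "async_reach (2 * L) (delta_notch L G) ?s ?t"
    using i flip
    by (intro async_reach_flip delta_state_cube)
      (auto simp: delta_notch_delta_state[OF nb] delta_state_simps)
  moreover have "async_reach (2 * L) (delta_notch L G) ?t (?t(i + L := \<not> ?t (i + L)))"
    using i t by (intro async_reach_flip) (auto simp: delta_notch_simps delta_state_simps)
  moreover have "?t(i + L := \<not> ?t (i + L)) = delta_state L D'"
    using i D' by (auto simp: delta_state_def fun_eq_iff)
  ultimately show ?thesis using async_reach_trans by metis
qed

lemma async_reach_independent:
  assumes nb: "\<And>i. neighbours G i \<subseteq> {1..L}" and "D \<subseteq> {1..L}"
  shows "\<exists>D'\<subseteq>{1..L}. (\<forall>i\<in>D'. neighbours G i \<inter> D' = {}) \<and>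
    async_reach (2 * L) (delta_notch L G) (delta_state L D) (delta_state L D')"
  using assms(2)
proof (induction "card D" arbitrary: D rule: less_induct)
  case less
  show ?case
  proof (cases "\<forall>i\<in>D. neighbours G i \<inter> D = {}")
    case True
    then show ?thesis
      using less.prems by (intro exI[of _ D] conjI async_reach_refl delta_state_cube)
  next
    case False
    then obtain i where i: "i \<in> D" "neighbours G i \<inter> D \<noteq> {}" by blast
    have "finite D" using less.prems finite_subset by blast
    then have "card (D - {i}) < card D" using i(1) by (intro card_Diff1_less)
    moreover have "async_reach (2 * L) (delta_notch L G) (delta_state L D) (delta_state L (D - {i}))"
      by (rule async_reach_toggle[OF nb, of i]) (use i less.prems in auto)
    moreover have "D - {i} \<subseteq> {1..L}" using less.prems by blast
    ultimately show ?thesis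
      using less.hyps[of "D - {i}"] async_reach_trans by meson
  qed
qed

lemma async_reach_maximal_independent:
  assumes nb: "\<And>i. neighbours G i \<subseteq> {1..L}"
    and sym: "\<And>i j. j \<in> neighbours G i \<Longrightarrow> i \<in> neighbours G j"
    and irrefl: "\<And>i. i \<notin> neighbours G i"
    and "D \<subseteq> {1..L}" and "\<forall>i\<in>D. neighbours G i \<inter> D = {}"
  shows "\<exists>D'. (\<forall>i\<in>{1..L}. i \<in> D' \<longleftrightarrow> neighbours G i \<inter> D' = {}) \<and>
    async_reach (2 * L) (delta_notch L G) (delta_state L D) (delta_state L D')"
  using assms(4,5)
proof (induction "card ({1..L} - D)" arbitrary: D rule: less_induct)
  case less
  show ?case
  proof (cases "\<forall>i\<in>{1..L}. i \<in> D \<longleftrightarrow> neighbours G i \<inter> D = {}")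
    case True
    then show ?thesis by (intro exI[of _ D] conjI async_reach_refl delta_state_cube)
  next
    case False
    \<comment> \<open>Since \<open>D\<close> is independent, the equivalence can fail only at a
      vertex outside \<open>D\<close> without neighbours in \<open>D\<close>.\<close>
    then obtain i where i: "i \<in> {1..L}" "i \<notin> D" "neighbours G i \<inter> D = {}"
      using less.prems by blast
    have "card ({1..L} - insert i D) < card ({1..L} - D)"
      using i by (intro psubset_card_mono) auto
    \<comment> \<open>A member of \<open>D\<close> adjacent to \<open>i\<close> would by symmetry be
      a neighbour of \<open>i\<close>, and \<open>i\<close> is not its own neighbour.\<close>
    moreover have "\<forall>j\<in>insert i D. neighbours G j \<inter> insert i D = {}"
      using less.prems(2) i sym irrefl by blast
    moreover have "async_reach (2 * L) (delta_notch L G) (delta_state L D) (delta_state L (insert i D))"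
      by (rule async_reach_toggle[OF nb, of i]) (use i in auto)
    ultimately show ?thesis
      using less.hyps[of "insert i D"] less.prems(1) i(1) async_reach_trans
      by (meson insert_subset)
  qed
qed

theorem theorem4:
  fixes L :: nat and G :: "nat pair_pre_digraph" and x :: "nat \<Rightarrow> bool"
  assumes "1 \<le> L"
    and "pair_graph G" and "pverts G = {1..L}" and "connected (with_proj G)"
    and "x \<in> cube (2 * L)" and "delta_notch L G x \<noteq> x"
  shows "\<exists>y p. y \<in> cube (2 * L) \<and> delta_notch L G y = y \<and>
    pre_digraph.apath (with_proj (AD (2 * L) (delta_notch L G))) x p y"
proof -
  interpret pair_graph G by fact
  have nb: "neighbours G i \<subseteq> {1..L}" for i
    using assms(3) by (auto simp: neighbours_def dest: in_arcsD2)
  have sym: "i \<in> neighbours G j" if "j \<in> neighbours G i" for i j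
    using that by (simp add: neighbours_def arcs_symmetric)
  have irrefl: "i \<notin> neighbours G i" for i
    by (auto simp: neighbours_def dest: no_loops')
  \<comment> \<open>Cutting down to the vertices leaves the state unchanged and gives the inclusion
    in \<open>{1..L}\<close> that the removal phase assumes.\<close>
  have "delta_state L {i. \<not> x i} = delta_state L {i \<in> {1..L}. \<not> x i}"
    by (auto simp: delta_state_def fun_eq_iff)
  then have reach1: "async_reach (2 * L) (delta_notch L G) x (delta_state L {i \<in> {1..L}. \<not> x i})"
    using async_reach_delta_state[OF assms(5)] by simp
  obtain D where D: "D \<subseteq> {1..L}" "\<forall>i\<in>D. neighbours G i \<inter> D = {}"
    and reach2: "async_reach (2 * L) (delta_notch L G)
      (delta_state L {i \<in> {1..L}. \<not> x i}) (delta_state L D)"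
    using async_reach_independent[OF nb, of "{i \<in> {1..L}. \<not> x i}"] by blast
  obtain E where E: "\<forall>i\<in>{1..L}. i \<in> E \<longleftrightarrow> neighbours G i \<inter> E = {}"
    and reach3: "async_reach (2 * L) (delta_notch L G) (delta_state L D) (delta_state L E)"
    using async_reach_maximal_independent[OF nb sym irrefl D] by auto
  have "async_reach (2 * L) (delta_notch L G) x (delta_state L E)"
    using reach1 reach2 reach3 by (blast intro: async_reach_trans)
  \<comment> \<open>Reachability yields a walk, which can be shortened to one without repeated
    states.\<close>
  then obtain p where
    "pre_digraph.apath (with_proj (AD (2 * L) (delta_notch L G))) x p (delta_state L E)"
    using wf_digraph.reachable_apath[OF wf_digraph_AD] by blast
  moreover have "delta_notch L G (delta_state L E) = delta_state L E"
    using E by (intro delta_state_fixed nb) auto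
  ultimately show ?thesis using delta_state_cube by blast
qed

end
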